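(* Let $G_1=([n],E_1)$ be an $n$-vertex graph of treewidth at most $k$, and $G_2=([n],E_2)$ an $n$-vertex graph of pathwidth at most $\ell$. Then there exists a permutation $\varphi\in S_n$ such that the union of $G_1$ and $G_2$ along $\varphi$ has treewidth at most $k+3\ell+1$.
   Context: $[n]=\{1,\dots,n\}$ and $S_n$ is the group of permutations of $[n]$. For $\varphi\in S_n$ and $E\subseteq\binom{[n]}{2}$, $\varphi(E)=\{\{\varphi(i),\varphi(j)\}:\{i,j\}\in E\}$. The union of $G_1=([n],E_1)$ and $G_2=([n],E_2)$ along $\varphi$ is the graph $([n],\varphi(E_1)\cup E_2)$. *)

theory Defs
  imports "HOL-Library.Ramsey" "HOL-Combinatorics.Permutations"
begin

text \<open>A finite simple graph is given by a vertex set \<open>V\<close> and an edge set \<open>E\<close> of two-element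
  subsets of \<open>V\<close>; \<open>nsets V 2\<close> is the set of all of these.\<close>

definition simple_graph :: "'a set \<Rightarrow> 'a set set \<Rightarrow> bool" where
  "simple_graph V E \<longleftrightarrow> finite V \<and> E \<subseteq> nsets V 2"

text \<open>Edges leaving \<open>V\<close> are ignored, so \<open>graph_connected U E\<close> for \<open>U \<subseteq> V\<close> says that the
  subgraph of \<open>(V, E)\<close> induced by \<open>U\<close> is connected. The empty graph is not connected.\<close>

definition graph_connected :: "'a set \<Rightarrow> 'a set set \<Rightarrow> bool" where
  "graph_connected V E \<longleftrightarrow>
     V \<noteq> {} \<and> (\<forall>u\<in>V. \<forall>v\<in>V. (u, v) \<in> {(x, y). x \<in> V \<and> y \<in> V \<and> {x, y} \<in> E}\<^sup>*)"

definition is_cycle :: "'a set set \<Rightarrow> 'a list \<Rightarrow> bool" where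
  "is_cycle E xs \<longleftrightarrow> length xs \<ge> 3 \<and> distinct xs \<and>
     (\<forall>i<length xs. {xs ! i, xs ! (Suc i mod length xs)} \<in> E)"

definition is_tree :: "'a set \<Rightarrow> 'a set set \<Rightarrow> bool" where
  "is_tree V E \<longleftrightarrow> simple_graph V E \<and> graph_connected V E \<and> (\<nexists>xs. is_cycle E xs)"

definition is_path :: "'a set \<Rightarrow> 'a set set \<Rightarrow> bool" where
  "is_path V E \<longleftrightarrow> (\<exists>xs. xs \<noteq> [] \<and> distinct xs \<and> V = set xs \<and>
     E = {{xs ! i, xs ! Suc i} |i. Suc i < length xs})"

definition decomposition ::
  "'a set \<Rightarrow> 'a set set \<Rightarrow> 'b set \<Rightarrow> 'b set set \<Rightarrow> ('b \<Rightarrow> 'a set) \<Rightarrow> bool" where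
  "decomposition V E T F B \<longleftrightarrow>
     (\<Union>t\<in>T. B t) = V \<and>
     (\<forall>e\<in>E. \<exists>t\<in>T. e \<subseteq> B t) \<and>
     (\<forall>v\<in>V. graph_connected {t\<in>T. v \<in> B t} F)"

definition tree_decomposition ::
  "'a set \<Rightarrow> 'a set set \<Rightarrow> 'b set \<Rightarrow> 'b set set \<Rightarrow> ('b \<Rightarrow> 'a set) \<Rightarrow> bool" where
  "tree_decomposition V E T F B \<longleftrightarrow> is_tree T F \<and> decomposition V E T F B"

definition path_decomposition ::
  "'a set \<Rightarrow> 'a set set \<Rightarrow> 'b set \<Rightarrow> 'b set set \<Rightarrow> ('b \<Rightarrow> 'a set) \<Rightarrow> bool" where
  "path_decomposition V E T F B \<longleftrightarrow> is_path T F \<and> decomposition V E T F B"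

definition decomposition_width :: "'b set \<Rightarrow> ('b \<Rightarrow> 'a set) \<Rightarrow> int" where
  "decomposition_width T B = int (Max ((\<lambda>t. card (B t)) ` T)) - 1"

text \<open>Decomposition trees and paths are finite, so taking their nodes from \<open>nat\<close> loses nothing.
  The widths are integers bounded below by \<open>-1\<close>, so the infima are minima; the value \<open>-1\<close> is
  attained only by the graph without vertices.\<close>

definition treewidth :: "'a set \<Rightarrow> 'a set set \<Rightarrow> int" where
  "treewidth V E = Inf {decomposition_width T B |(T :: nat set) F B. tree_decomposition V E T F B}"

definition pathwidth :: "'a set \<Rightarrow> 'a set set \<Rightarrow> int" where
  "pathwidth V E = Inf {decomposition_width T B |(T :: nat set) F B. path_decomposition V E T F B}"

definition permute_edges :: "('a \<Rightarrow> 'a) \<Rightarrow> 'a set set \<Rightarrow> 'a set set" where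
  "permute_edges \<phi> E = {{\<phi> i, \<phi> j} |i j. {i, j} \<in> E}"

definition union_along :: "('a \<Rightarrow> 'a) \<Rightarrow> 'a set set \<Rightarrow> 'a set set \<Rightarrow> 'a set set" where
  "union_along \<phi> E1 E2 = permute_edges \<phi> E1 \<union> E2"

lemma int_Inf_le_iff:
  fixes S :: "int set"
  assumes "S \<noteq> {}" "\<And>w. w \<in> S \<Longrightarrow> -1 \<le> w"
  shows "Inf S \<le> k \<longleftrightarrow> (\<exists>w\<in>S. w \<le> k)"
proof -
  have bdd: "bdd_below S" using assms(2) by (rule bdd_belowI)
  show ?thesis
  proof
    assume "Inf S \<le> k"
    then have "Inf S < k + 1" by simp
    then obtain w where "w \<in> S" "w < k + 1" using cInf_less_iff[OF assms(1) bdd] by blast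
    then show "\<exists>w\<in>S. w \<le> k" by (auto intro: bexI[of _ w])
  next
    assume "\<exists>w\<in>S. w \<le> k"
    then show "Inf S \<le> k" using cInf_lower[OF _ bdd] order_trans by blast
  qed
qed

lemma trivial_decomposition:
  assumes "simple_graph V E"
  shows "decomposition V E {0::nat} {} (\<lambda>_. V)"
  using assms by (auto simp: simple_graph_def decomposition_def graph_connected_def nsets_def)

lemma treewidth_le_iff:
  assumes "simple_graph V E"
  shows "treewidth V E \<le> k \<longleftrightarrow>
    (\<exists>(T :: nat set) F B. tree_decomposition V E T F B \<and> decomposition_width T B \<le> k)"
proof -
  have "is_tree {0::nat} {}"
    unfolding is_tree_def is_cycle_def simple_graph_def graph_connected_def
    by (auto intro!: exI[of _ 0])
  then have "tree_decomposition V E {0::nat} {} (\<lambda>_. V)"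
    using trivial_decomposition[OF assms] by (simp add: tree_decomposition_def)
  then show ?thesis unfolding treewidth_def
    by (subst int_Inf_le_iff) (auto simp: decomposition_width_def)
qed

lemma pathwidth_le_iff:
  assumes "simple_graph V E"
  shows "pathwidth V E \<le> k \<longleftrightarrow>
    (\<exists>(T :: nat set) F B. path_decomposition V E T F B \<and> decomposition_width T B \<le> k)"
proof -
  have "is_path {0::nat} {}"
    unfolding is_path_def by (auto intro!: exI[of _ "[0]"])
  then have "path_decomposition V E {0::nat} {} (\<lambda>_. V)"
    using trivial_decomposition[OF assms] by (simp add: path_decomposition_def)
  then show ?thesis unfolding pathwidth_def
    by (subst int_Inf_le_iff) (auto simp: decomposition_width_def)
qed

end

theory Submission
  imports Defs
begin

text \<open>
  Order the vertices of \<open>G\<^sub>2\<close> by the left endpoints of their intervals in the path decomposition: at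
  every position at most \<open>l\<close> earlier vertices have a neighbour at or after it. Order the vertices of
  \<open>G\<^sub>1\<close> by a depth-first traversal of a binary decomposition tree, so that every subtree owns a
  segment of the order, and match the two orders. It is then enough to add to the bag of a node the
  at most three separators at the ends of its segment and between the segments of its children,
  each of size at most \<open>l\<close>.
\<close>

section \<open>Join trees: rooted trees of bags\<close>

text \<open>Nodes are not named: only the set of bags and the root bag are kept. \<open>glue\<close>
  hangs the root \<open>Y\<close> of one tree below the root \<open>X\<close> of another, so a node
  with many children arises from repeated binary steps. The condition on the two unions is the
  connectivity axiom of a tree decomposition, stated locally at the new edge.\<close>

inductive join_tree :: "'a set set \<Rightarrow> 'a set \<Rightarrow> bool" where
  single: "join_tree {X} X"
| glue: "join_tree A X \<Longrightarrow> join_tree B Y \<Longrightarrow> \<Union>A \<inter> \<Union>B \<subseteq> X \<inter> Y \<Longrightarrow> join_tree (A \<union> B) X"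

lemma join_tree_root: "join_tree A X \<Longrightarrow> X \<in> A"
  by (induction rule: join_tree.induct) auto

text \<open>The induction descends into the part that contains \<open>X\<close>. A vertex that
  \<open>Y\<close> shares with the other part lies in \<open>X\<close>, so both parts shared it
  already and the condition at the gluing edge survives.\<close>

lemma join_tree_insert_leaf:
  assumes "join_tree A R" "X \<in> A" "Y \<inter> \<Union>A \<subseteq> X"
  shows "join_tree (insert Y A) R"
  using assms
proof (induction arbitrary: X rule: join_tree.induct)
  case (single R)
  have "join_tree ({R} \<union> {Y}) R"
    by (rule glue[OF join_tree.single join_tree.single]) (use single in auto)
  then show ?case by (simp add: insert_commute)
next
  case (glue A R B Q)
  show ?case
  proof (cases "X \<in> A")
    case True
    then have "join_tree (insert Y A) R" using glue by blast
    moreover have "\<Union>(insert Y A) \<inter> \<Union>B \<subseteq> R \<inter> Q" using glue True by blast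
    ultimately have "join_tree (insert Y A \<union> B) R" using glue.hyps by (blast intro: join_tree.glue)
    then show ?thesis by simp
  next
    case False
    then have "X \<in> B" using glue by blast
    then have "join_tree (insert Y B) Q" using glue by blast
    moreover have "\<Union>A \<inter> \<Union>(insert Y B) \<subseteq> R \<inter> Q" using glue \<open>X \<in> B\<close> by blast
    ultimately have "join_tree (A \<union> insert Y B) R" using glue.hyps by (blast intro: join_tree.glue)
    then show ?thesis by simp
  qed
qed

lemma join_tree_new_root:
  assumes "join_tree A X" "Y \<inter> \<Union>A \<subseteq> X"
  shows "join_tree (insert Y A) Y"
proof -
  have "join_tree ({Y} \<union> A) Y"
    by (rule glue[OF single assms(1)]) (use assms in auto)
  then show ?thesis by simp
qed

text \<open>Injectivity makes images commute with the intersection in the gluing condition. This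
  later carries a finished tree along a permutation.\<close>

lemma join_tree_image:
  assumes "join_tree A X" "inj_on f (\<Union>A)"
  shows "join_tree ((`) f ` A) (f ` X)"
  using assms
proof (induction rule: join_tree.induct)
  case (single X)
  then show ?case by (simp add: join_tree.single)
next
  case (glue A X B Y)
  have inj: "inj_on f (\<Union>A)" "inj_on f (\<Union>B)"
    using glue.prems by (auto intro: inj_on_subset)
  have "f ` (\<Union>A) \<inter> f ` (\<Union>B) = f ` (\<Union>A \<inter> \<Union>B)"
    using inj_on_image_Int[OF glue.prems, of "\<Union>A" "\<Union>B"] by auto
  also have "\<dots> \<subseteq> f ` X \<inter> f ` Y" using glue.hyps by blast
  finally have "\<Union>((`) f ` A) \<inter> \<Union>((`) f ` B) \<subseteq> f ` X \<inter> f ` Y"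
    by (simp add: image_Union)
  then show ?case using glue.IH inj by (simp add: image_Un join_tree.glue)
qed

section \<open>Join trees and tree decompositions\<close>

abbreviation adjacency :: "'a set \<Rightarrow> 'a set set \<Rightarrow> 'a rel" where
  "adjacency V E \<equiv> {(x, y). x \<in> V \<and> y \<in> V \<and> {x, y} \<in> E}"

text \<open>The path is built step by step. When the next vertex already occurs, the path is cut off
  at that occurrence, so it stays simple.\<close>

lemma rtrancl_distinct_path:
  assumes "(x, y) \<in> r\<^sup>*"
  shows "\<exists>xs. xs \<noteq> [] \<and> distinct xs \<and> hd xs = x \<and> last xs = y \<and>
    (\<forall>i. Suc i < length xs \<longrightarrow> (xs ! i, xs ! Suc i) \<in> r)"
  using assms
proof (induction rule: rtrancl_induct)
  case base
  then show ?case by (intro exI[of _ "[x]"]) auto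
next
  case (step y z)
  then obtain xs where xs: "xs \<noteq> []" "distinct xs" "hd xs = x" "last xs = y"
    "\<And>i. Suc i < length xs \<Longrightarrow> (xs ! i, xs ! Suc i) \<in> r" by blast
  show ?case
  proof (cases "z \<in> set xs")
    case True
    then obtain j where j: "j < length xs" "xs ! j = z" by (auto simp: in_set_conv_nth)
    then have "length (take (Suc j) xs) = Suc j" by simp
    then show ?thesis
      using xs j by (intro exI[of _ "take (Suc j) xs"]) (auto simp: hd_take last_conv_nth simp del: length_take)
  next
    case False
    have "((xs @ [z]) ! i, (xs @ [z]) ! Suc i) \<in> r" if "Suc i < length (xs @ [z])" for i
    proof (cases "Suc i < length xs")
      case True
      then show ?thesis using xs by (simp add: nth_append)
    next
      case False
      then have "i = length xs - 1" "Suc i = length xs" using that by auto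
      then show ?thesis using xs step.hyps by (simp add: nth_append last_conv_nth)
    qed
    then show ?thesis using xs False by (intro exI[of _ "xs @ [z]"]) auto
  qed
qed

text \<open>A connection avoiding the edge would contain a simple path from \<open>t\<close> to
  \<open>u\<close>, and the edge would close it to a cycle.\<close>

lemma acyclic_edge_is_bridge:
  assumes "\<nexists>xs. is_cycle F xs" "{u, t} \<in> F" "u \<noteq> t"
  shows "(t, u) \<notin> {(x, y). {x, y} \<in> F - {{u, t}}}\<^sup>*"
proof
  assume "(t, u) \<in> {(x, y). {x, y} \<in> F - {{u, t}}}\<^sup>*"
  from rtrancl_distinct_path[OF this] obtain xs where xs: "xs \<noteq> []" "distinct xs"
    "hd xs = t" "last xs = u" "\<And>i. Suc i < length xs \<Longrightarrow> {xs ! i, xs ! Suc i} \<in> F - {{u, t}}"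
    by blast
  have first: "xs ! 0 = t" and final: "xs ! (length xs - 1) = u"
    using xs by (auto simp: hd_conv_nth last_conv_nth)
  \<comment> \<open>Length 1 would give \<open>t = u\<close>, and length 2 would use the removed
    edge itself.\<close>
  have "length xs \<noteq> 0" using xs by simp
  moreover have "length xs \<noteq> 1" using first final assms by auto
  moreover have "length xs \<noteq> 2" using first final xs(5)[of 0] by (auto simp: insert_commute)
  ultimately have len: "length xs \<ge> 3" by linarith
  have "{xs ! i, xs ! (Suc i mod length xs)} \<in> F" if "i < length xs" for i
  proof (cases "Suc i < length xs")
    case True
    then show ?thesis using xs(5) by auto
  next
    case False
    then have "Suc i = length xs" using that by simp
    moreover from this have "i = length xs - 1" by simp
    ultimately show ?thesis using first final assms(2) by simp
  qed
  then have "is_cycle F xs" using len xs by (simp add: is_cycle_def)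
  then show False using assms by blast
qed

lemma rtrancl_leaves_set:
  assumes "(x, y) \<in> r\<^sup>*" "x \<in> S" "y \<notin> S"
  shows "\<exists>a b. (a, b) \<in> r \<and> a \<in> S \<and> b \<notin> S"
  using assms by (induction rule: rtrancl_induct) auto

lemma graph_connected_insert:
  assumes "graph_connected U F" "u \<in> U" "{u, t} \<in> F"
  shows "graph_connected (insert t U) F"
proof -
  let ?r = "adjacency (insert t U) F"
  have "adjacency U F \<subseteq> ?r" by auto
  then have U: "(x, y) \<in> ?r\<^sup>*" if "x \<in> U" "y \<in> U" for x y
    using assms(1) that rtrancl_mono unfolding graph_connected_def by blast
  have "(u, t) \<in> ?r" "(t, u) \<in> ?r" using assms by (auto simp: insert_commute)
  then have "(x, t) \<in> ?r\<^sup>*" "(t, x) \<in> ?r\<^sup>*" if "x \<in> U" for x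
    using U[OF that assms(2)] U[OF assms(2) that]
    by (auto intro: rtrancl_into_rtrancl converse_rtrancl_into_rtrancl)
  then show ?thesis using U unfolding graph_connected_def by auto
qed

lemma graph_connected_mono:
  assumes "graph_connected U F" "F \<subseteq> F'"
  shows "graph_connected U F'"
proof -
  have "adjacency U F \<subseteq> adjacency U F'" using assms by auto
  then show ?thesis using assms(1) rtrancl_mono unfolding graph_connected_def by blast
qed

text \<open>If a shared vertex \<open>v\<close> were missing from \<open>B u\<close>, the nodes
  holding \<open>v\<close> would lead from \<open>t\<close> to a node of \<open>S\<close> without
  touching \<open>u\<close>, and \<open>S\<close> would lead on to \<open>u\<close> without touching
  \<open>t\<close>. Together they would bypass the edge between \<open>u\<close> and
  \<open>t\<close>, which is a bridge.\<close>

lemma tree_decomposition_adjacent_bag: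
  assumes "tree_decomposition V E T F B"
    and S: "graph_connected S F" "u \<in> S" "S \<subseteq> T" and t: "t \<in> T" "t \<notin> S" "{u, t} \<in> F"
  shows "B t \<inter> \<Union>(B ` S) \<subseteq> B u"
proof
  fix v assume v: "v \<in> B t \<inter> \<Union>(B ` S)"
  then obtain s where s: "s \<in> S" "v \<in> B s" by blast
  show "v \<in> B u"
  proof (rule ccontr)
    assume u: "v \<notin> B u"
    let ?r = "{(x, y). {x, y} \<in> F - {{u, t}}}"
    have conn: "graph_connected {t \<in> T. v \<in> B t} F"
      using assms(1) v t unfolding tree_decomposition_def decomposition_def by blast
    have "adjacency {t \<in> T. v \<in> B t} F \<subseteq> ?r" using u by (auto simp: doubleton_eq_iff)
    then have "(t, s) \<in> ?r\<^sup>*"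
      using conn s v t S rtrancl_mono unfolding graph_connected_def by blast
    moreover have "adjacency S F \<subseteq> ?r" using t by (auto simp: doubleton_eq_iff)
    then have "(s, u) \<in> ?r\<^sup>*"
      using S s rtrancl_mono unfolding graph_connected_def by blast
    ultimately have "(t, u) \<in> ?r\<^sup>*" by (rule rtrancl_trans)
    moreover have "\<nexists>xs. is_cycle F xs" using assms(1) by (auto simp: tree_decomposition_def is_tree_def)
    ultimately show False using acyclic_edge_is_bridge[of F u t] t S by blast
  qed
qed

text \<open>A connected set of nodes grows from a single node by one adjacent node at a time. By
  \<open>tree_decomposition_adjacent_bag\<close> each new bag can be attached as a leaf.\<close>

lemma tree_decomposition_join_tree:
  assumes "tree_decomposition V E T F B"
  shows "\<exists>R. join_tree (B ` T) R"
proof -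
  have tree: "finite T" "graph_connected T F"
    using assms by (auto simp: tree_decomposition_def is_tree_def simple_graph_def)
  have grow: "\<exists>R. join_tree (B ` T) R"
    if "graph_connected S F" "S \<subseteq> T" "join_tree (B ` S) R" for S R
    using that
  proof (induction "card (T - S)" arbitrary: S rule: less_induct)
    case less
    show ?case
    proof (cases "S = T")
      case True
      then show ?thesis using less by blast
    next
      case False
      then obtain y where y: "y \<in> T" "y \<notin> S" using less by blast
      obtain x where x: "x \<in> S" using less by (auto simp: graph_connected_def)
      have "(x, y) \<in> (adjacency T F)\<^sup>*"
        using tree x y less unfolding graph_connected_def by blast
      from rtrancl_leaves_set[OF this x y(2)] obtain u t
        where ut: "u \<in> S" "t \<notin> S" "t \<in> T" "{u, t} \<in> F" by auto
      have "B t \<inter> \<Union>(B ` S) \<subseteq> B u"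
        using tree_decomposition_adjacent_bag[OF assms] less ut by blast
      then have "join_tree (insert (B t) (B ` S)) R"
        using join_tree_insert_leaf less ut by blast
      moreover have "card (T - insert t S) < card (T - S)"
        using ut tree by (intro psubset_card_mono) auto
      moreover have "graph_connected (insert t S) F"
        using graph_connected_insert less ut by metis
      ultimately show ?thesis using less.hyps[of "insert t S"] less.prems ut by simp
    qed
  qed
  obtain r where "r \<in> T" using tree by (auto simp: graph_connected_def)
  then show ?thesis
    using grow[of "{r}" "B r"] by (auto simp: graph_connected_def join_tree.single)
qed

section \<open>From join trees back to tree decompositions\<close>

text \<open>The cyclic predecessor and successor of \<open>t\<close> are at different positions
  because a cycle has at least three vertices.\<close>

lemma cycle_two_neighbours:
  assumes "is_cycle E xs" "t \<in> set xs"
  shows "\<exists>a b. a \<noteq> b \<and> {t, a} \<in> E \<and> {t, b} \<in> E"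
proof -
  let ?n = "length xs"
  have xs: "?n \<ge> 3" "distinct xs" "\<And>i. i < ?n \<Longrightarrow> {xs ! i, xs ! (Suc i mod ?n)} \<in> E"
    using assms(1) by (auto simp: is_cycle_def)
  obtain i where i: "i < ?n" "xs ! i = t" using assms(2) by (auto simp: in_set_conv_nth)
  define j where "j = (if i = 0 then ?n - 1 else i - 1)"
  have j: "j < ?n" "Suc j mod ?n = i" using i xs(1) by (auto simp: j_def)
  have "Suc i mod ?n \<noteq> j"
  proof (cases "Suc i = ?n")
    case True
    then show ?thesis using xs(1) by (auto simp: j_def)
  next
    case False
    then have "Suc i mod ?n = Suc i" using i by simp
    then show ?thesis using xs(1) by (auto simp: j_def)
  qed
  moreover have "Suc i mod ?n < ?n" by (rule mod_less_divisor[OF le_less_trans[OF le0 i(1)]])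
  ultimately have "xs ! (Suc i mod ?n) \<noteq> xs ! j" using xs j by (simp add: nth_eq_iff_index_eq)
  moreover have "{t, xs ! (Suc i mod ?n)} \<in> E" using xs(3)[of i] i by simp
  moreover have "{t, xs ! j} \<in> E" using xs(3)[of j] i j by (simp add: insert_commute)
  ultimately show ?thesis by blast
qed

text \<open>The new node has \<open>u\<close> as its only neighbour, so no cycle passes through it
  by \<open>cycle_two_neighbours\<close>; a cycle avoiding it cannot use the new edge and was
  present before.\<close>

lemma is_tree_insert_leaf:
  assumes "is_tree T F" "u \<in> T" "t \<notin> T"
  shows "is_tree (insert t T) (insert {u, t} F)"
proof -
  have T: "finite T" "F \<subseteq> nsets T 2" "graph_connected T F" "\<nexists>xs. is_cycle F xs"
    using assms(1) by (auto simp: is_tree_def simple_graph_def)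
  have "insert {u, t} F \<subseteq> nsets (insert t T) 2"
    using T(2) assms(2,3) by (auto simp: nsets_def card_insert_if)
  moreover have "graph_connected (insert t T) (insert {u, t} F)"
    using T assms by (auto intro: graph_connected_insert graph_connected_mono)
  moreover have False if cyc: "is_cycle (insert {u, t} F) xs" for xs
  proof (cases "t \<in> set xs")
    case True
    have "a = u" if "{t, a} \<in> insert {u, t} F" for a
      using that T(2) assms by (auto simp: nsets_def doubleton_eq_iff)
    then show False using cycle_two_neighbours[OF cyc True] by metis
  next
    case False
    have "{xs ! i, xs ! (Suc i mod length xs)} \<noteq> {u, t}" if "i < length xs" for i
    proof -
      have "Suc i mod length xs < length xs" by (rule mod_less_divisor[OF le_less_trans[OF le0 that]])
      then show ?thesis using False that by (metis insertCI insertE nth_mem singletonD)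
    qed
    then have "is_cycle F xs" using cyc by (auto simp: is_cycle_def)
    then show False using T by blast
  qed
  ultimately show ?thesis using T(1) by (auto simp: is_tree_def simple_graph_def)
qed

text \<open>This is a tree decomposition without its graph, on the node type that
  \<open>treewidth\<close> uses. Covering vertices and edges depends on the set of bags alone, so
  only the tree and the connectivity have to be rebuilt. Several nodes may carry the same
  bag.\<close>

definition tree_bags :: "'a set set \<Rightarrow> bool" where
  "tree_bags A \<longleftrightarrow> (\<exists>(T :: nat set) F B. is_tree T F \<and> B ` T = A \<and>
     (\<forall>v\<in>\<Union>A. graph_connected {t\<in>T. v \<in> B t} F))"

lemma tree_bags_single: "tree_bags {X}"
proof -
  have "is_tree {0::nat} {}"
    unfolding is_tree_def is_cycle_def simple_graph_def graph_connected_def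
    by (auto intro!: exI[of _ 0])
  then show ?thesis
    unfolding tree_bags_def by (intro exI[of _ "{0}"] exI[of _ "{}"] exI[of _ "\<lambda>_. X"])
      (auto simp: graph_connected_def)
qed

text \<open>A fresh node carrying \<open>Y\<close> is hung on a node carrying \<open>X\<close>. A
  vertex that \<open>Y\<close> shares with old bags lies in \<open>X\<close>, so its node set gains
  a neighbour of one of its members; a vertex new in \<open>Y\<close> occupies the fresh node
  alone.\<close>

lemma tree_bags_insert:
  assumes "tree_bags A" "X \<in> A" "Y \<inter> \<Union>A \<subseteq> X"
  shows "tree_bags (insert Y A)"
proof -
  obtain T :: "nat set" and F B where T: "is_tree T F" "B ` T = A"
    "\<And>v. v \<in> \<Union>A \<Longrightarrow> graph_connected {t\<in>T. v \<in> B t} F"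
    using assms(1) unfolding tree_bags_def by blast
  have "finite T" using T(1) by (simp add: is_tree_def simple_graph_def)
  then obtain t where t: "t \<notin> T" using ex_new_if_finite infinite_UNIV_nat by blast
  obtain u where u: "u \<in> T" "B u = X" using T assms(2) by blast
  let ?F = "insert {u, t} F" and ?B = "B(t := Y)"
  have conn: "graph_connected {s \<in> insert t T. v \<in> ?B s} ?F" if "v \<in> \<Union>(insert Y A)" for v
  proof (cases "v \<in> \<Union>A")
    case True
    have old: "graph_connected {t\<in>T. v \<in> B t} ?F"
      using T(3)[OF True] by (rule graph_connected_mono) auto
    show ?thesis
    proof (cases "v \<in> Y")
      case True
      then have "v \<in> B u" using assms(3) \<open>v \<in> \<Union>A\<close> u by blast
      then have "graph_connected (insert t {t\<in>T. v \<in> B t}) ?F"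
        using graph_connected_insert[OF old, of u t] u by simp
      moreover have "insert t {t\<in>T. v \<in> B t} = {s \<in> insert t T. v \<in> ?B s}"
        using t True by auto
      ultimately show ?thesis by simp
    next
      case False
      then have "{t\<in>T. v \<in> B t} = {s \<in> insert t T. v \<in> ?B s}" using t by auto
      then show ?thesis using old by simp
    qed
  next
    case False
    then have "{s \<in> insert t T. v \<in> ?B s} = {t}" using t that T(2) by auto
    then show ?thesis by (simp add: graph_connected_def)
  qed
  moreover have "?B ` insert t T = insert Y A" using T(2) t by auto
  ultimately show ?thesis
    unfolding tree_bags_def using is_tree_insert_leaf[OF T(1) u(1) t] by blast
qed

text \<open>The induction is over the tree being attached, while \<open>A\<close> and the attachment
  bag stay arbitrary. A glued tree is attached in two rounds: its first part at \<open>X\<close>,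
  then its second part at the root of the first. In this way bags arrive one at a time, as
  leaves.\<close>

lemma tree_bags_union:
  assumes "join_tree B Y" "tree_bags A" "X \<in> A" "\<Union>A \<inter> \<Union>B \<subseteq> X \<inter> Y"
  shows "tree_bags (A \<union> B)"
  using assms
proof (induction arbitrary: A X rule: join_tree.induct)
  case (single Y)
  then have "tree_bags (insert Y A)" by (intro tree_bags_insert) auto
  then show ?case by simp
next
  case (glue B Y C Z)
  have "tree_bags (A \<union> B)" using glue by blast
  moreover have "Y \<in> A \<union> B" using glue join_tree_root by blast
  \<comment> \<open>A vertex common to \<open>A\<close> and \<open>C\<close> lies in
    \<open>Y\<close> by the premise, hence also in the first part, so the gluing condition between
    \<open>B\<close> and \<open>C\<close> applies to it.\<close>
  moreover have "\<Union>(A \<union> B) \<inter> \<Union>C \<subseteq> Y \<inter> Z"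
    using glue.hyps glue.prems join_tree_root[OF glue.hyps(1)] by blast
  ultimately have "tree_bags (A \<union> B \<union> C)" by (rule glue.IH(2))
  then show ?case by (simp add: Un_assoc)
qed

lemma join_tree_tree_bags:
  assumes "join_tree A X"
  shows "tree_bags A"
proof -
  \<comment> \<open>The tree is attached to a copy of its own root, which adds nothing to the set of
    bags.\<close>
  have "tree_bags ({X} \<union> A)"
    by (rule tree_bags_union[OF assms tree_bags_single]) auto
  then show ?thesis using join_tree_root[OF assms] by (simp add: insert_absorb)
qed

lemma decomposition_width_le_iff:
  assumes "finite T" "T \<noteq> {}"
  shows "decomposition_width T B \<le> int k \<longleftrightarrow> (\<forall>t\<in>T. card (B t) \<le> Suc k)"
proof -
  have "decomposition_width T B \<le> int k \<longleftrightarrow> Max ((\<lambda>t. card (B t)) ` T) \<le> Suc k"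
    by (auto simp: decomposition_width_def)
  then show ?thesis using assms by simp
qed

text \<open>This allows the merging argument to be carried out entirely on join trees.\<close>

lemma treewidth_le_iff_join_tree:
  assumes "simple_graph V E"
  shows "treewidth V E \<le> int k \<longleftrightarrow>
    (\<exists>A R. join_tree A R \<and> \<Union>A = V \<and> (\<forall>e\<in>E. \<exists>X\<in>A. e \<subseteq> X) \<and> (\<forall>X\<in>A. card X \<le> Suc k))"
    (is "_ \<longleftrightarrow> ?J")
proof
  assume "treewidth V E \<le> int k"
  then obtain T :: "nat set" and F B where
    T: "tree_decomposition V E T F B" "decomposition_width T B \<le> int k"
    using assms by (auto simp: treewidth_le_iff)
  obtain R where R: "join_tree (B ` T) R" using tree_decomposition_join_tree[OF T(1)] by blast
  have "finite T" "T \<noteq> {}"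
    using T(1) by (auto simp: tree_decomposition_def is_tree_def simple_graph_def graph_connected_def)
  then have "\<forall>X\<in>B ` T. card X \<le> Suc k" using T(2) by (simp add: decomposition_width_le_iff)
  moreover have "\<Union>(B ` T) = V" "\<forall>e\<in>E. \<exists>X\<in>B ` T. e \<subseteq> X"
    using T(1) by (auto simp: tree_decomposition_def decomposition_def)
  ultimately show ?J using R by blast
next
  assume ?J
  then obtain A R where A: "join_tree A R" "\<Union>A = V" "\<forall>e\<in>E. \<exists>X\<in>A. e \<subseteq> X"
    "\<forall>X\<in>A. card X \<le> Suc k" by blast
  obtain T :: "nat set" and F B where T: "is_tree T F" "B ` T = A"
    "\<forall>v\<in>\<Union>A. graph_connected {t\<in>T. v \<in> B t} F"
    using join_tree_tree_bags[OF A(1)] unfolding tree_bags_def by blast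
  have "finite T" "T \<noteq> {}"
    using T(1) by (auto simp: is_tree_def simple_graph_def graph_connected_def)
  then have "decomposition_width T B \<le> int k" using A T by (auto simp: decomposition_width_le_iff)
  moreover have "tree_decomposition V E T F B"
    using A T by (auto simp: tree_decomposition_def decomposition_def)
  ultimately show "treewidth V E \<le> int k" using assms by (auto simp: treewidth_le_iff)
qed

section \<open>Separators of a vertex order\<close>

text \<open>\<open>S i\<close> models the vertices before position \<open>i\<close> that have a
  neighbour at or after it. By the last clause a vertex that has dropped out never returns, so the
  sets \<open>insert (w i) (S i)\<close> behave like the bags of a path decomposition. Edges do not
  occur, which makes the notion easy to transport along a permutation.\<close>

definition separators :: "nat \<Rightarrow> nat \<Rightarrow> (nat \<Rightarrow> 'a) \<Rightarrow> (nat \<Rightarrow> 'a set) \<Rightarrow> bool" where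
  "separators n l w S \<longleftrightarrow> inj_on w {..<n} \<and>
     (\<forall>i\<le>n. S i \<subseteq> w ` {..<i} \<and> card (S i) \<le> l) \<and>
     (\<forall>i<n. S (Suc i) \<subseteq> insert (w i) (S i))"

lemma separators_step:
  assumes "separators n l w S" "i \<le> j" "j \<le> n"
  shows "S j \<subseteq> S i \<union> w ` {i..<j}"
  using assms(2,3)
proof (induction j rule: dec_induct)
  case (step j)
  have "S (Suc j) \<subseteq> insert (w j) (S j)" using assms(1) step by (simp add: separators_def)
  then show ?case using step by (auto simp: atLeastLessThanSuc)
qed simp

text \<open>Each earlier vertex with a neighbour at or after position \<open>i\<close> lies in the
  bag where the interval of \<open>w i\<close> begins. That bag also contains \<open>w i\<close>,
  which leaves room for at most \<open>l\<close> such vertices.\<close>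

lemma path_decomposition_order:
  assumes "simple_graph V E" "pathwidth V E \<le> int l"
  shows "\<exists>w S. bij_betw w {..<card V} V \<and> separators (card V) l w S \<and>
    (\<forall>e\<in>E. \<exists>i<card V. e \<subseteq> insert (w i) (S i))"
proof -
  obtain T :: "nat set" and F B where
    T: "path_decomposition V E T F B" "decomposition_width T B \<le> int l"
    using assms by (auto simp: pathwidth_le_iff)
  obtain xs where xs: "xs \<noteq> []" "distinct xs" "T = set xs"
    "F = {{xs ! i, xs ! Suc i} |i. Suc i < length xs}"
    using T(1) unfolding path_decomposition_def is_path_def by blast
  have dec: "(\<Union>t\<in>T. B t) = V" "\<And>e. e \<in> E \<Longrightarrow> \<exists>t\<in>T. e \<subseteq> B t"
    "\<And>v. v \<in> V \<Longrightarrow> graph_connected {t\<in>T. v \<in> B t} F"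
    using T(1) unfolding path_decomposition_def decomposition_def by auto
  have finV: "finite V" using assms(1) by (simp add: simple_graph_def)
  have width: "card (B t) \<le> Suc l" if "t \<in> T" for t
    using T(2) xs that by (auto simp: decomposition_width_le_iff)
  have interval: "v \<in> B (xs ! b)"
    if "a \<le> b" "b \<le> c" "c < length xs" "v \<in> B (xs ! a)" "v \<in> B (xs ! c)" for a b c v
  proof (rule ccontr)
    assume b: "v \<notin> B (xs ! b)"
    have "a \<noteq> b" "b \<noteq> c" using b that(4,5) by auto
    then have ab: "a < b" and bc: "b < c" using that(1,2) by simp_all
    \<comment> \<open>The path is cut just before position \<open>b\<close>. A walk from
      \<open>xs ! a\<close> to \<open>xs ! c\<close> inside the bags of \<open>v\<close> must cross
      the cut, and the only edge across it ends in \<open>xs ! b\<close>.\<close>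
    let ?S = "(!) xs ` {..<b}"
    have U: "xs ! a \<in> {t\<in>T. v \<in> B t}" "xs ! c \<in> {t\<in>T. v \<in> B t}"
      using that xs(3) by simp_all
    then have "v \<in> V" using dec(1) by blast
    from dec(3)[OF this] U have reach: "(xs ! a, xs ! c) \<in> (adjacency {t\<in>T. v \<in> B t} F)\<^sup>*"
      unfolding graph_connected_def by blast
    have "xs ! a \<in> ?S" using ab by (intro imageI) simp
    moreover have "xs ! c \<notin> ?S"
    proof
      assume "xs ! c \<in> ?S"
      then obtain d where "d < b" "xs ! c = xs ! d" by blast
      then show False using xs(2) bc that(3) by (simp add: nth_eq_iff_index_eq)
    qed
    ultimately obtain x y where "(x, y) \<in> adjacency {t\<in>T. v \<in> B t} F \<and> x \<in> ?S \<and> y \<notin> ?S"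
      using rtrancl_leaves_set[OF reach, of ?S] by meson
    then have xy: "(x, y) \<in> adjacency {t\<in>T. v \<in> B t} F" "x \<in> ?S" "y \<notin> ?S" by blast+
    have edge: "{x, y} \<in> F" "v \<in> B y" using xy(1) by simp_all
    from edge(1) obtain i where i: "Suc i < length xs" "{x, y} = {xs ! i, xs ! Suc i}"
      unfolding xs(4) by blast
    obtain j where j: "j < b" "x = xs ! j" using xy(2) by blast
    have "j < length xs" using j bc that(3) by simp
    consider "x = xs ! i" "y = xs ! Suc i" | "x = xs ! Suc i" "y = xs ! i"
      using i(2) unfolding doubleton_eq_iff by blast
    then show False
    proof cases
      case 1
      then have "j = i" using j i(1) \<open>j < length xs\<close> xs(2) by (simp add: nth_eq_iff_index_eq)
      moreover have "\<not> Suc i < b" using xy(3) 1(2) by blast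
      ultimately have "Suc i = b" using j(1) by simp
      then show False using b 1(2) edge(2) by simp
    next
      case 2
      then have "j = Suc i" using j i(1) \<open>j < length xs\<close> xs(2) by (simp add: nth_eq_iff_index_eq)
      then have "i < b" using j(1) by simp
      then show False using xy(3) 2(2) by blast
    qed
  qed
  define left where "left v = (LEAST i. i < length xs \<and> v \<in> B (xs ! i))" for v
  have left: "left v < length xs" "v \<in> B (xs ! left v)" if "v \<in> V" for v
  proof -
    have "\<exists>i. i < length xs \<and> v \<in> B (xs ! i)"
      using that dec(1) xs(3) by (auto simp: in_set_conv_nth)
    from LeastI_ex[OF this] show "left v < length xs" "v \<in> B (xs ! left v)"
      by (auto simp: left_def)
  qed
  have left_le: "left v \<le> i" if "i < length xs" "v \<in> B (xs ! i)" for v i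
    unfolding left_def using that by (intro Least_le) simp
  obtain vs where vs: "set vs = V" "distinct vs" using finite_distinct_list[OF finV] by blast
  define ws where "ws = sort_key left vs"
  have ws: "distinct ws" "set ws = V" using vs by (simp_all add: ws_def)
  then have len: "length ws = card V" using distinct_card by fastforce
  have sorted: "left (ws ! i) \<le> left (ws ! j)" if "i \<le> j" "j < card V" for i j
    using sorted_nth_mono[of "map left ws" i j] that len by (simp add: ws_def)
  define S where "S i = {ws ! j |j. j < i \<and> (\<exists>m\<ge>i. m < card V \<and> {ws ! j, ws ! m} \<in> E)}" for i
  have card: "card (S i) \<le> l" if "i \<le> card V" for i
  proof (cases "i = card V")
    case True
    then have "S i = {}" by (auto simp: S_def)
    then show ?thesis by simp
  next
    case False
    then have i: "i < card V" using that by simp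
    let ?t = "xs ! left (ws ! i)"
    have i': "ws ! i \<in> V" using nth_mem[of i ws] ws len i by simp
    \<comment> \<open>The interval of \<open>v\<close> begins no later than that of
      \<open>ws ! i\<close> and reaches a bag shared with \<open>ws ! m\<close>. That bag is no
      earlier than the left end of \<open>ws ! i\<close>, since \<open>m\<close> is at least
      \<open>i\<close>. So the interval of \<open>v\<close> passes through
      \<open>?t\<close>.\<close>
    have "S i \<subseteq> B ?t"
    proof
      fix v assume "v \<in> S i"
      then obtain j m where j: "v = ws ! j" "j < i" "i \<le> m" "m < card V" "{v, ws ! m} \<in> E"
        by (auto simp: S_def)
      obtain t where t: "t \<in> T" "{v, ws ! m} \<subseteq> B t" using dec(2)[OF j(5)] by blast
      then obtain b where b: "b < length xs" "v \<in> B (xs ! b)" "ws ! m \<in> B (xs ! b)"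
        using xs(3) by (auto simp: in_set_conv_nth)
      have "v \<in> V" using nth_mem[of j ws] ws len i j by simp
      moreover have "left v \<le> left (ws ! i)" "left (ws ! i) \<le> b"
        using sorted[of j i] sorted[of i m] left_le[OF b(1,3)] i j by auto
      ultimately show "v \<in> B ?t" using interval[of "left v" "left (ws ! i)" b v] left b by blast
    qed
    moreover have "ws ! i \<notin> S i" using ws(1) len i by (auto simp: S_def nth_eq_iff_index_eq)
    moreover have "ws ! i \<in> B ?t" "?t \<in> T" using left[OF i'] xs(3) by auto
    ultimately have t: "insert (ws ! i) (S i) \<subseteq> B ?t" "ws ! i \<notin> S i" "?t \<in> T" by blast+
    have "finite (B ?t)" using t(3) dec(1) finV by (metis UN_upper finite_subset)
    then have "card (insert (ws ! i) (S i)) \<le> Suc l" "finite (S i)"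
      using card_mono[OF _ t(1)] width[OF t(3)] t(1) finite_subset by auto
    then show ?thesis using t(2) by simp
  qed
  have bij: "bij_betw ((!) ws) {..<card V} V" using bij_betw_nth[OF ws(1)] len ws(2) by simp
  have "separators (card V) l ((!) ws) S"
    unfolding separators_def
  proof (intro conjI allI impI)
    show "inj_on ((!) ws) {..<card V}" using bij by (simp add: bij_betw_def)
    show "S (Suc i) \<subseteq> insert (ws ! i) (S i)" for i
      unfolding S_def by (auto simp: less_Suc_eq) (metis Suc_leD)
  qed (use card in \<open>auto simp: S_def\<close>)
  moreover have "\<exists>i<card V. e \<subseteq> insert (ws ! i) (S i)" if e: "e \<in> E" for e
  proof -
    have "e \<in> nsets V 2" using assms(1) e by (auto simp: simple_graph_def)
    then obtain x y where xy: "e = {x, y}" "x \<in> V" "y \<in> V" "x \<noteq> y"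
      by (auto simp: nsets_def card_2_iff)
    obtain i j where ij: "i < card V" "j < card V" "x = ws ! i" "y = ws ! j"
      using xy ws len in_set_conv_nth[of x ws] in_set_conv_nth[of y ws] by auto
    \<comment> \<open>An edge is covered at the position \<open>b\<close> of its later endpoint,
      because the earlier endpoint then belongs to \<open>S b\<close>.\<close>
    have *: "\<exists>i<card V. {ws ! a, ws ! b} \<subseteq> insert (ws ! i) (S i)"
      if "a < b" "b < card V" "{ws ! a, ws ! b} \<in> E" for a b
      using that by (intro exI[of _ b]) (auto simp: S_def)
    show ?thesis
    proof (cases "i < j")
      case True
      then show ?thesis using *[of i j] ij xy e by simp
    next
      case False
      then have "j < i" using ij xy by (metis linorder_neqE_nat)
      then show ?thesis using *[of j i] ij xy e by (simp add: insert_commute)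
    qed
  qed
  ultimately show ?thesis using bij by blast
qed

section \<open>Merging a decomposition tree with a vertex order\<close>

text \<open>In its applications the segment from \<open>p\<close> to \<open>q\<close> lists the
  vertices of \<open>A\<close> outside the root \<open>R\<close>; the vertices of \<open>R\<close>
  are placed later, further up the tree. The bound on the union of \<open>C\<close> controls the
  overlaps when two merged trees are glued, and the root exposes the separators at both ends of the
  segment.\<close>

definition merged :: "'a set set \<Rightarrow> 'a set \<Rightarrow> nat \<Rightarrow> (nat \<Rightarrow> 'a) \<Rightarrow> (nat \<Rightarrow> 'a set) \<Rightarrow>
    nat \<Rightarrow> nat \<Rightarrow> 'a set set \<Rightarrow> bool" where
  "merged A R m w S p q C \<longleftrightarrow> join_tree C (R \<union> S p \<union> S q) \<and> (\<forall>Z\<in>C. card Z \<le> m) \<and>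
     \<Union>C \<subseteq> R \<union> S p \<union> w ` {p..<q} \<and> (\<forall>X\<in>A. \<exists>Z\<in>C. X \<subseteq> Z) \<and>
     (\<forall>i\<in>{p..<q}. \<exists>Z\<in>C. insert (w i) (S i) \<subseteq> Z)"

lemma merged_single:
  assumes "separators n l w S" "p \<le> n" "card X \<le> Suc k"
  shows "merged {X} X (k + 3 * l + 1) w S p p {X \<union> S p}"
proof -
  have "card (S p) \<le> l" using assms by (simp add: separators_def)
  then have "card (X \<union> S p) \<le> k + 3 * l + 1" using card_Un_le[of X "S p"] assms by simp
  then show ?thesis by (auto simp: merged_def Un_assoc intro: join_tree.single)
qed

text \<open>The segment consists of that of \<open>A\<close>, that of \<open>B\<close>, and then
  \<open>Y - X\<close>, the vertices lost on passing from \<open>Y\<close> up to \<open>X\<close>.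
  Both merged trees hang below the bag \<open>?M\<close>, which holds the separators at
  \<open>p\<close>, \<open>p1\<close> and \<open>q\<close>. The bag \<open>?P\<close> above it drops
  \<open>S p1\<close> and restores the form demanded of a root.\<close>

lemma merged_glue:
  assumes sep: "separators n l w S"
    and pos: "p \<le> p1" "p1 \<le> p2" "p2 \<le> q" "q \<le> n"
    and seg: "w ` {p..<p1} = \<Union>A - X" "w ` {p1..<p2} = \<Union>B - Y" "w ` {p2..<q} = Y - X"
    and int: "\<Union>A \<inter> \<Union>B \<subseteq> X \<inter> Y" and roots: "X \<subseteq> \<Union>A" "Y \<subseteq> \<Union>B"
    and cardX: "card X \<le> Suc k"
    and a: "merged A X (k + 3 * l + 1) w S p p1 Ca"
    and b: "merged B Y (k + 3 * l + 1) w S p1 p2 Cb"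
  shows "\<exists>C. merged (A \<union> B) X (k + 3 * l + 1) w S p q C"
proof -
  let ?P = "X \<union> S p \<union> S q" and ?M = "X \<union> S p \<union> S p1 \<union> S q"
  have Ca: "join_tree Ca (X \<union> S p \<union> S p1)" "\<Union>Ca \<subseteq> X \<union> S p \<union> w ` {p..<p1}"
    "\<And>Z. Z \<in> Ca \<Longrightarrow> card Z \<le> k + 3 * l + 1" "\<And>Z. Z \<in> A \<Longrightarrow> \<exists>Z'\<in>Ca. Z \<subseteq> Z'"
    "\<And>i. i \<in> {p..<p1} \<Longrightarrow> \<exists>Z\<in>Ca. insert (w i) (S i) \<subseteq> Z"
    using a by (auto simp: merged_def)
  have Cb: "join_tree Cb (Y \<union> S p1 \<union> S p2)" "\<Union>Cb \<subseteq> Y \<union> S p1 \<union> w ` {p1..<p2}"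
    "\<And>Z. Z \<in> Cb \<Longrightarrow> card Z \<le> k + 3 * l + 1" "\<And>Z. Z \<in> B \<Longrightarrow> \<exists>Z'\<in>Cb. Z \<subseteq> Z'"
    "\<And>i. i \<in> {p1..<p2} \<Longrightarrow> \<exists>Z\<in>Cb. insert (w i) (S i) \<subseteq> Z"
    using b by (auto simp: merged_def)
  have inj: "inj_on w {..<n}" using sep by (simp add: separators_def)
  have S: "S i \<subseteq> w ` {..<i}" "card (S i) \<le> l" if "i \<le> n" for i
    using sep that by (simp_all add: separators_def)
  have disj: "w ` I \<inter> w ` J = {}" if "I \<inter> J = {}" "I \<subseteq> {..<n}" "J \<subseteq> {..<n}" for I J
    using inj_on_image_Int[OF inj that(2,3)] that(1) by simp
  have before: "S i \<inter> w ` {j..<j'} = {}" if "i \<le> j" "j' \<le> n" for i j j'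
  proof (cases "j < j'")
    case True
    then have "w ` {..<i} \<inter> w ` {j..<j'} = {}" using that by (intro disj) auto
    then show ?thesis using S(1)[of i] that True by auto
  qed simp
  have segs: "w ` {p..<p1} \<inter> w ` {p1..<p2} = {}" "w ` {p..<p1} \<inter> w ` {p1..<q} = {}"
    "w ` {p1..<p2} \<inter> w ` {p2..<q} = {}"
    by (rule disj; use pos in auto)+
  have steps: "S q \<subseteq> S p1 \<union> w ` {p1..<q}" "S q \<subseteq> S p2 \<union> w ` {p2..<q}"
    "S p1 \<subseteq> S p \<union> w ` {p..<p1}" "S q \<subseteq> S p \<union> w ` {p..<q}"
    using separators_step[OF sep] pos by auto
  \<comment> \<open>A vertex of either child segment that is still in the separator at
    \<open>q\<close> was already in the separator at the end of its own segment.\<close>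
  have first: "S q \<inter> w ` {p..<p1} \<subseteq> S p1" using steps segs by blast
  have second: "S q \<inter> w ` {p1..<p2} \<subseteq> S p2" using steps segs by blast
  have Sp: "S p \<inter> w ` {p1..<p2} = {}" "S p1 \<inter> w ` {p1..<p2} = {}"
    using before pos by auto
  \<comment> \<open>By the gluing condition each root meets the other tree only inside the root of
    that tree, and the child segments leave out their own roots.\<close>
  have La: "w ` {p..<p1} \<inter> X = {}" "w ` {p..<p1} \<inter> Y = {}" and Lb: "w ` {p1..<p2} \<inter> X = {}"
    using seg int roots by auto

  have "?M \<inter> \<Union>Ca \<subseteq> X \<union> S p \<union> S p1" using Ca(2) first by blast
  then have MCa: "join_tree (insert ?M Ca) ?M" by (rule join_tree_new_root[OF Ca(1)])
  have "\<Union>Ca \<inter> \<Union>Cb \<subseteq> (X \<union> S p \<union> S p1) \<inter> (Y \<union> S p1)"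
    using Ca(2) Cb(2) La Lb Sp segs(1) by blast
  moreover have "?M \<inter> \<Union>Cb \<subseteq> Y \<union> S p1 \<union> S p2"
    using Cb(2) Lb Sp second by blast
  ultimately have "\<Union>(insert ?M Ca) \<inter> \<Union>Cb \<subseteq> ?M \<inter> (Y \<union> S p1 \<union> S p2)" by auto
  then have "join_tree (insert ?M Ca \<union> Cb) ?M" by (rule join_tree.glue[OF MCa Cb(1)])
  then have "join_tree (insert ?P (insert ?M Ca \<union> Cb)) ?P"
    by (rule join_tree_new_root) auto
  moreover have "card Z \<le> k + 3 * l + 1" if "Z \<in> insert ?P (insert ?M Ca \<union> Cb)" for Z
  proof -
    \<comment> \<open>The bound comes from \<open>?M\<close>: at most \<open>Suc k\<close> vertices
      of \<open>X\<close> and three separators.\<close>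
    have "card (S p) \<le> l" "card (S p1) \<le> l" "card (S q) \<le> l" using S(2) pos by simp_all
    then have "card ?P \<le> k + 3 * l + 1" "card ?M \<le> k + 3 * l + 1"
      using cardX card_Un_le[of X "S p"] card_Un_le[of "X \<union> S p" "S q"]
        card_Un_le[of "X \<union> S p" "S p1"] card_Un_le[of "X \<union> S p \<union> S p1" "S q"] by linarith+
    then show ?thesis using that Ca(3) Cb(3) by blast
  qed
  moreover have "\<Union>(insert ?P (insert ?M Ca \<union> Cb)) \<subseteq> X \<union> S p \<union> w ` {p..<q}"
  proof -
    let ?U = "X \<union> S p \<union> w ` {p..<q}"
    have sub: "w ` {p..<p1} \<subseteq> ?U" "w ` {p1..<p2} \<subseteq> ?U" "w ` {p2..<q} \<subseteq> ?U"
      using pos by (auto intro!: image_mono le_supI2)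
    have "Y \<subseteq> X \<union> w ` {p2..<q}" using seg(3) by blast
    then have "Y \<subseteq> ?U" using sub(3) by blast
    moreover have "S p1 \<subseteq> ?U" using steps(3) sub(1) by blast
    ultimately have "Y \<union> S p1 \<union> w ` {p1..<p2} \<subseteq> ?U" using sub(2) by simp
    then have "\<Union>Cb \<subseteq> ?U" using Cb(2) by (rule order_trans[rotated])
    moreover have "X \<union> S p \<union> w ` {p..<p1} \<subseteq> ?U" using sub(1) by simp
    then have "\<Union>Ca \<subseteq> ?U" using Ca(2) by (rule order_trans[rotated])
    moreover have "S q \<subseteq> ?U" using steps(4) by blast
    ultimately show ?thesis using \<open>S p1 \<subseteq> ?U\<close> by simp
  qed
  moreover have "\<exists>Z'\<in>insert ?P (insert ?M Ca \<union> Cb). Z \<subseteq> Z'" if "Z \<in> A \<union> B" for Z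
    using that
  proof
    assume "Z \<in> A"
    from Ca(4)[OF this] show ?thesis by blast
  next
    assume "Z \<in> B"
    from Cb(4)[OF this] show ?thesis by blast
  qed
  moreover have "\<exists>Z\<in>insert ?P (insert ?M Ca \<union> Cb). insert (w i) (S i) \<subseteq> Z" if i: "i \<in> {p..<q}" for i
  proof -
    consider "i \<in> {p..<p1}" | "i \<in> {p1..<p2}" | "i \<in> {p2..<q}" using i by fastforce
    then show ?thesis
    proof cases
      case 1
      from Ca(5)[OF this] show ?thesis by blast
    next
      case 2
      from Cb(5)[OF this] show ?thesis by blast
    next
      case 3
      \<comment> \<open>The positions of \<open>Y - X\<close> get no bag of their own: a separator
        there contains only vertices of \<open>S p2\<close> and of \<open>Y - X\<close>, all of
        which are in the root of \<open>Cb\<close>.\<close>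
      then have "S i \<subseteq> S p2 \<union> w ` {p2..<i}" using separators_step[OF sep] pos by auto
      moreover have "w ` {p2..<i} \<subseteq> w ` {p2..<q}" using 3 by (auto intro!: image_mono)
      moreover have "w i \<in> w ` {p2..<q}" using 3 by blast
      ultimately have "insert (w i) (S i) \<subseteq> Y \<union> S p1 \<union> S p2" using seg(3) by blast
      then show ?thesis using join_tree_root[OF Cb(1)] by blast
    qed
  qed
  ultimately have "merged (A \<union> B) X (k + 3 * l + 1) w S p q (insert ?P (insert ?M Ca \<union> Cb))"
    unfolding merged_def by simp
  then show ?thesis ..
qed

text \<open>The list \<open>L\<close> is chosen before \<open>n\<close>, \<open>w\<close>,
  \<open>S\<close> and \<open>p\<close>: it depends on the tree and can be matched with any order of
  the other graph. Since \<open>p\<close> is arbitrary, \<open>L\<close> can serve as a segment of a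
  longer order. The root vertices are left out because they may still be shared with the tree
  above.\<close>

lemma join_tree_merge:
  assumes "join_tree A R" "\<forall>X\<in>A. finite X \<and> card X \<le> Suc k"
  shows "\<exists>L. distinct L \<and> set L = \<Union>A - R \<and> (\<forall>n w S p. separators n l w S \<longrightarrow>
    p + length L \<le> n \<longrightarrow> map w [p..<p + length L] = L \<longrightarrow>
    (\<exists>C. merged A R (k + 3 * l + 1) w S p (p + length L) C))"
  using assms
proof (induction rule: join_tree.induct)
  case (single X)
  then have X: "card X \<le> Suc k" by simp
  have "\<exists>C. merged {X} X (k + 3 * l + 1) w S p (p + length []) C"
    if "separators n l w S" "p + length [] \<le> n" for n w S p
  proof
    show "merged {X} X (k + 3 * l + 1) w S p (p + length []) {X \<union> S p}"
      using merged_single[OF that(1) _ X, of p] that(2) by simp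
  qed
  then show ?case by (intro exI[of _ "[]"] conjI allI impI) simp_all
next
  case (glue A X B Y)
  let ?merge = "\<lambda>A R L. \<forall>n w S p. separators n l w S \<longrightarrow> p + length L \<le> n \<longrightarrow>
    map w [p..<p + length L] = L \<longrightarrow> (\<exists>C. merged A R (k + 3 * l + 1) w S p (p + length L) C)"
  have fin: "\<forall>X\<in>A. finite X \<and> card X \<le> Suc k" "\<forall>X\<in>B. finite X \<and> card X \<le> Suc k"
    using glue.prems by blast+
  from glue.IH(1)[OF fin(1)] glue.IH(2)[OF fin(2)] obtain La Lb where La: "distinct La" "set La = \<Union>A - X" "?merge A X La"
    and Lb: "distinct Lb" "set Lb = \<Union>B - Y" "?merge B Y Lb"
    by (elim exE conjE)
  have roots: "X \<in> A" "Y \<in> B" using glue.hyps join_tree_root by blast+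
  then have "finite (Y - X)" using glue.prems by blast
  then obtain Ls where Ls: "set Ls = Y - X" "distinct Ls" using finite_distinct_list by blast
  \<comment> \<open>In this depth-first order each subtree owns a consecutive block. The vertices of
    \<open>Y\<close> absent from \<open>X\<close> follow directly after the block of
    \<open>B\<close>.\<close>
  let ?L = "La @ Lb @ Ls"
  have L: "distinct ?L" "set ?L = \<Union>(A \<union> B) - X"
    using La(1,2) Lb(1,2) Ls glue.hyps(3) roots by auto
  have merge: "\<exists>C. merged (A \<union> B) X (k + 3 * l + 1) w S p (p + length ?L) C"
    if w: "separators n l w S" "p + length ?L \<le> n" "map w [p..<p + length ?L] = ?L" for n w S p
  proof -
    let ?p1 = "p + length La" and ?p2 = "p + length La + length Lb"
    have "[p..<p + length ?L] = [p..<?p1] @ [?p1..<?p2] @ [?p2..<?p2 + length Ls]"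
      using upt_add_eq_append[of p ?p1 "length Lb + length Ls"]
        upt_add_eq_append[of ?p1 ?p2 "length Ls"] by (simp add: add.assoc)
    then have "map w [p..<?p1] @ map w [?p1..<?p2] @ map w [?p2..<?p2 + length Ls] = ?L"
      using w(3) by (simp only: map_append)
    then have parts: "map w [p..<?p1] = La" "map w [?p1..<?p2] = Lb" "map w [?p2..<?p2 + length Ls] = Ls"
      by simp_all
    have img: "w ` {i..<j} = set K" if "map w [i..<j] = K" for i j K
      using arg_cong[OF that, of set] by simp
    obtain Ca where Ca: "merged A X (k + 3 * l + 1) w S p ?p1 Ca"
      using La(3)[rule_format, OF w(1) _ parts(1)] w(2) by auto
    obtain Cb where Cb: "merged B Y (k + 3 * l + 1) w S ?p1 ?p2 Cb"
      using Lb(3)[rule_format, OF w(1) _ parts(2)] w(2) by auto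
    have seg: "w ` {p..<?p1} = \<Union>A - X" "w ` {?p1..<?p2} = \<Union>B - Y"
      "w ` {?p2..<?p2 + length Ls} = Y - X"
      using img[OF parts(1)] img[OF parts(2)] img[OF parts(3)] La(2) Lb(2) Ls(1) by simp_all
    have "X \<subseteq> \<Union>A" "Y \<subseteq> \<Union>B" "card X \<le> Suc k" using roots fin(1) by blast+
    from merged_glue[OF w(1) _ _ _ _ seg glue.hyps(3) this Ca Cb]
    have "\<exists>C. merged (A \<union> B) X (k + 3 * l + 1) w S p (?p2 + length Ls) C" using w(2) by simp
    then show ?thesis by (simp add: add.assoc)
  qed
  have merge_L: "?merge (A \<union> B) X ?L" by (intro allI impI) (rule merge)
  show ?case
    by (rule exI[of _ ?L], rule conjI[OF L(1) conjI[OF L(2) merge_L]])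
qed

section \<open>Matching the two orders by a permutation\<close>

text \<open>The merging takes place on the vertices as named in \<open>E1\<close>: the separators of
  \<open>E2\<close> are pulled back along \<open>\<phi>\<close>, and the finished join tree is
  mapped forward by \<open>\<phi>\<close>.\<close>

lemma treewidth_union_along:
  assumes "simple_graph V E1" "treewidth V E1 \<le> int k" "simple_graph V E2" "pathwidth V E2 \<le> int l"
  shows "\<exists>\<phi>. \<phi> permutes V \<and> treewidth V (union_along \<phi> E1 E2) \<le> int (k + 3 * l)"
proof -
  have finV: "finite V" using assms by (simp add: simple_graph_def)
  obtain A R where A: "join_tree A R" "\<Union>A = V" "\<And>e. e \<in> E1 \<Longrightarrow> \<exists>X\<in>A. e \<subseteq> X"
    "\<forall>X\<in>A. card X \<le> Suc k"
    using assms(2) unfolding treewidth_le_iff_join_tree[OF assms(1)] by blast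
  have finA: "finite X" if "X \<in> A" for X using that A(2) finV by (metis Union_upper finite_subset)
  have R: "R \<subseteq> V" "finite R" using join_tree_root[OF A(1)] A(2) finA by auto
  obtain L where L: "distinct L" "set L = V - R"
    "\<And>n w S p. separators n l w S \<Longrightarrow> p + length L \<le> n \<Longrightarrow> map w [p..<p + length L] = L \<Longrightarrow>
      \<exists>C. merged A R (k + 3 * l + 1) w S p (p + length L) C"
    using join_tree_merge[OF A(1), of k l] A(2,4) finA by metis
  obtain Lr where Lr: "set Lr = R" "distinct Lr" using finite_distinct_list[OF R(2)] by blast
  \<comment> \<open>The vertices of the root, which \<open>L\<close> omits, come last.\<close>
  define w1 where "w1 = (!) (L @ Lr)"
  have order: "distinct (L @ Lr)" "set (L @ Lr) = V" using L(1,2) Lr R(1) by auto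
  have len: "length L + length Lr = card V"
    using distinct_card[OF order(1)] unfolding order(2) by simp
  have w1: "bij_betw w1 {..<card V} V"
    unfolding w1_def by (rule bij_betw_nth[OF order(1)]) (use len order(2) in simp_all)
  obtain w2 S2 where w2: "bij_betw w2 {..<card V} V" "separators (card V) l w2 S2"
    "\<And>e. e \<in> E2 \<Longrightarrow> \<exists>i<card V. e \<subseteq> insert (w2 i) (S2 i)"
    using path_decomposition_order[OF assms(3,4)] by blast
  \<comment> \<open>\<open>\<psi>\<close> matches vertices at equal positions of the two orders;
    \<open>\<phi>\<close> extends it by the identity outside \<open>V\<close>.\<close>
  define \<psi> where "\<psi> = w2 \<circ> inv_into {..<card V} w1"
  have \<psi>: "bij_betw \<psi> V V"
    unfolding \<psi>_def using bij_betw_trans[OF bij_betw_inv_into[OF w1] w2(1)] .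
  have \<psi>w: "\<psi> (w1 i) = w2 i" if "i < card V" for i
    using bij_betw_inv_into_left[OF w1] that by (simp add: \<psi>_def)
  define \<phi> where "\<phi> x = (if x \<in> V then \<psi> x else x)" for x
  have \<phi>: "\<phi> permutes V"
    using \<psi> by (intro bij_imp_permutes) (auto simp: \<phi>_def cong: bij_betw_cong)
  have w1V: "w1 i \<in> V" if "i < card V" for i using w1 that by (auto simp: bij_betw_def)
  have \<phi>w: "\<phi> (w1 i) = w2 i" if "i < card V" for i using \<psi>w w1V that by (simp add: \<phi>_def)
  have inj: "inj \<phi>" using \<phi> by (rule permutes_inj)
  define S1 where "S1 i = \<phi> -` S2 i" for i
  have surj: "\<phi> ` S1 i = S2 i" for i
    unfolding S1_def using permutes_surj[OF \<phi>] by (rule surj_image_vimage_eq)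
  have S2: "S2 i \<subseteq> w2 ` {..<i}" "card (S2 i) \<le> l" if "i \<le> card V" for i
    using w2(2) that by (simp_all add: separators_def)
  have sep: "separators (card V) l w1 S1"
    unfolding separators_def
  proof (intro conjI allI impI)
    show "inj_on w1 {..<card V}" using w1 by (simp add: bij_betw_def)
    show "card (S1 i) \<le> l" if "i \<le> card V" for i
      using S2(2)[OF that] surj[of i] card_image[OF inj_on_subset[OF inj], of "S1 i"] by simp
    show "S1 i \<subseteq> w1 ` {..<i}" if i: "i \<le> card V" for i
    proof
      fix x assume "x \<in> S1 i"
      then obtain j where j: "j < i" "\<phi> x = w2 j" using S2(1)[OF i] by (auto simp: S1_def)
      then have "\<phi> x = \<phi> (w1 j)" using \<phi>w[of j] i by simp
      then have "x = w1 j" using inj by (rule injD[rotated])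
      then show "x \<in> w1 ` {..<i}" using j(1) by simp
    qed
    show "S1 (Suc i) \<subseteq> insert (w1 i) (S1 i)" if "i < card V" for i
    proof
      fix x assume "x \<in> S1 (Suc i)"
      then have "\<phi> x \<in> insert (\<phi> (w1 i)) (S2 i)"
        using w2(2) that \<phi>w[OF that] by (auto simp: S1_def separators_def)
      then show "x \<in> insert (w1 i) (S1 i)" using inj by (auto simp: S1_def dest: injD)
    qed
  qed
  have map_w1: "map w1 [0..<0 + length L] = L"
    by (rule nth_equalityI) (auto simp: w1_def nth_append)
  from L(3)[OF sep _ map_w1] len obtain C where C: "merged A R (k + 3 * l + 1) w1 S1 0 (length L) C"
    by auto
  have root: "join_tree C (R \<union> S1 0 \<union> S1 (length L))"
    using C unfolding merged_def by (rule conjunct1)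
  \<comment> \<open>Nothing precedes position 0, so the bags of \<open>C\<close> contain only
    vertices of \<open>R\<close> and of the segment \<open>L\<close>.\<close>
  have S0: "S1 0 = {}" using S2(1)[of 0] by (simp add: S1_def)
  have imgL: "w1 ` {0..<length L} = V - R"
    using arg_cong[OF map_w1, of set] L(2) by simp
  have C_union: "\<Union>C = V"
  proof
    show "\<Union>C \<subseteq> V" using C S0 imgL R by (auto simp: merged_def)
    show "V \<subseteq> \<Union>C" using C A(2) unfolding merged_def by blast
  qed
  have C_edge1: "\<exists>Z\<in>C. e \<subseteq> Z" if "e \<in> E1" for e
    using A(3)[OF that] C unfolding merged_def by (meson order_trans)
  have C_edge2: "\<exists>Z\<in>C. insert (w1 i) (S1 i) \<subseteq> Z" if i: "i < card V" for i
  proof (cases "i < length L")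
    case True
    then show ?thesis using C by (simp add: merged_def)
  next
    case False
    \<comment> \<open>From \<open>length L\<close> on, only vertices of \<open>R\<close> occur. The
      root bag of \<open>C\<close> contains all of them together with the separator at
      \<open>length L\<close>, so it covers every remaining position.\<close>
    have R_img: "w1 ` {length L..<card V} \<subseteq> R"
      using Lr(1) len by (auto simp: w1_def nth_append)
    have "S1 i \<subseteq> S1 (length L) \<union> w1 ` {length L..<i}"
      using separators_step[OF sep] False i by simp
    moreover have "w1 ` {length L..<i} \<subseteq> w1 ` {length L..<card V}" using i by (auto intro!: image_mono)
    moreover have "w1 i \<in> w1 ` {length L..<card V}" using i False by simp
    ultimately have "insert (w1 i) (S1 i) \<subseteq> R \<union> S1 0 \<union> S1 (length L)" using R_img by blast
    then show ?thesis by (rule bexI[OF _ join_tree_root[OF root]])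
  qed
  have graph: "simple_graph V (union_along \<phi> E1 E2)"
  proof -
    have "permute_edges \<phi> E1 \<subseteq> nsets V 2"
    proof
      fix e assume "e \<in> permute_edges \<phi> E1"
      then obtain i j where ij: "e = {\<phi> i, \<phi> j}" "{i, j} \<in> E1" by (auto simp: permute_edges_def)
      then have "{i, j} \<in> nsets V 2" using assms(1) unfolding simple_graph_def by blast
      then have "i \<in> V" "j \<in> V" "i \<noteq> j" by (auto simp: nsets_def)
      then show "e \<in> nsets V 2"
        using ij inj permutes_in_image[OF \<phi>] by (auto simp: nsets_def inj_eq)
    qed
    then show ?thesis using assms by (auto simp: simple_graph_def union_along_def)
  qed
  let ?D = "(`) \<phi> ` C"
  have "join_tree ?D (\<phi> ` (R \<union> S1 0 \<union> S1 (length L)))"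
    by (rule join_tree_image[OF root inj_on_subset[OF inj subset_UNIV]])
  moreover have "\<Union>?D = V"
    using C_union permutes_image[OF \<phi>] by (metis image_Union)
  moreover have "\<exists>X\<in>?D. e \<subseteq> X" if "e \<in> union_along \<phi> E1 E2" for e
    using that unfolding union_along_def
  proof
    assume "e \<in> permute_edges \<phi> E1"
    then obtain i j where ij: "e = \<phi> ` {i, j}" "{i, j} \<in> E1" by (auto simp: permute_edges_def)
    obtain Z where Z: "Z \<in> C" "{i, j} \<subseteq> Z" using C_edge1[OF ij(2)] by (elim bexE)
    show ?thesis unfolding ij(1) by (rule bexI[of _ "\<phi> ` Z"]) (use Z in \<open>auto intro: image_mono\<close>)
  next
    assume "e \<in> E2"
    then obtain i where i: "i < card V" "e \<subseteq> insert (w2 i) (S2 i)" using w2(3) by blast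
    then have e: "e \<subseteq> \<phi> ` insert (w1 i) (S1 i)" using \<phi>w surj by simp
    obtain Z where Z: "Z \<in> C" "insert (w1 i) (S1 i) \<subseteq> Z" using C_edge2[OF i(1)] by (elim bexE)
    have "e \<subseteq> \<phi> ` Z" using e image_mono[OF Z(2)] by (rule order_trans)
    then show ?thesis by (rule bexI[of _ "\<phi> ` Z"]) (use Z(1) in simp)
  qed
  moreover have "card X \<le> Suc (k + 3 * l)" if "X \<in> ?D" for X
    using that C card_image[OF inj_on_subset[OF inj subset_UNIV]] by (auto simp: merged_def)
  ultimately have "treewidth V (union_along \<phi> E1 E2) \<le> int (k + 3 * l)"
    unfolding treewidth_le_iff_join_tree[OF graph] by blast
  then show ?thesis using \<phi> by blast
qed

theorem theorem3:
  fixes n k l :: nat and E1 E2 :: "nat set set"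
  assumes "simple_graph {1..n} E1" and "treewidth {1..n} E1 \<le> int k"
    and "simple_graph {1..n} E2" and "pathwidth {1..n} E2 \<le> int l"
  shows "\<exists>\<phi>. \<phi> permutes {1..n} \<and>
    treewidth {1..n} (union_along \<phi> E1 E2) \<le> int (k + 3 * l + 1)"
  \<comment> \<open>The construction achieves \<open>k + 3 * l\<close>, one less than the stated
    bound.\<close>
  using treewidth_union_along[OF assms] by force

end
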